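(* For every $\epsilon>0$ there is an $N>0$ such that for every even $n>N$, $$\bigl|\{F\in\mathcal{G}'_{16}(n):\ \alpha(\pi(F))>0.454\,n\}\bigr|<\epsilon\,(3n-1)!!.$$
   Context: Configuration model: for an even positive integer $n$, let $V_n=[n]=\{1,\dots,n\}$ (the vertices) and $W_n=V_n\times[3]$ (the points). A pairing (configuration) is a perfect matching on $W_n$; $\mathcal{F}_3(n)$ is the set of all $(3n-1)!!$ pairings. For $F\in\mathcal{F}_3(n)$, $\pi(F)$ is the 3-regular multigraph on $V_n$ obtained by replacing each point $(v,k)$ by its first coordinate $v$ (so each matching edge becomes an edge of $\pi(F)$, possibly a loop or a multiple edge). $\mathcal{G}_g(n)$ is the set of simple cubic (3-regular) graphs on $[n]$ with girth at least $g$, and $\mathcal{G}'_g(n)=\{F\in\mathcal{F}_3(n):\pi(F)\in\mathcal{G}_g(n)\}$. $\alpha(\cdot)$ denotes the independence number. *)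

theory Defs
  imports Complex_Main
begin

fun dfact :: "nat \<Rightarrow> nat" where
  "dfact 0 = 1"
| "dfact (Suc 0) = 1"
| "dfact (Suc (Suc k)) = Suc (Suc k) * dfact k"

definition points :: "nat \<Rightarrow> (nat \<times> nat) set" where
  "points n = {1..n} \<times> {1..3}"

definition pairings :: "nat \<Rightarrow> (nat \<times> nat) set set set" where
  "pairings n = {F. F \<subseteq> {{a, b} | a b. a \<in> points n \<and> b \<in> points n \<and> a \<noteq> b}
                    \<and> (\<forall>x\<in>points n. \<exists>!e\<in>F. x \<in> e)}"

text \<open>Adjacency in the projected multigraph pi(F) (ignoring loops).\<close>
definition adj :: "(nat \<times> nat) set set \<Rightarrow> nat \<Rightarrow> nat \<Rightarrow> bool" where
  "adj F u v \<longleftrightarrow> u \<noteq> v \<and> (\<exists>e\<in>F. fst ` e = {u, v})"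

definition simple_proj :: "(nat \<times> nat) set set \<Rightarrow> bool" where
  "simple_proj F \<longleftrightarrow> (\<forall>e\<in>F. card (fst ` e) = 2) \<and> inj_on (\<lambda>e. fst ` e) F"

definition cubic_proj :: "nat \<Rightarrow> (nat \<times> nat) set set \<Rightarrow> bool" where
  "cubic_proj n F \<longleftrightarrow> (\<forall>v\<in>{1..n}. card {u. adj F v u} = 3)"

definition has_cycle_len :: "(nat \<times> nat) set set \<Rightarrow> nat \<Rightarrow> bool" where
  "has_cycle_len F k \<longleftrightarrow> 3 \<le> k \<and> (\<exists>vs. length vs = k \<and> distinct vs \<and>
       (\<forall>i<k. adj F (vs ! i) (vs ! ((i + 1) mod k))))"

definition girth_ge :: "(nat \<times> nat) set set \<Rightarrow> nat \<Rightarrow> bool" where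
  "girth_ge F g \<longleftrightarrow> (\<forall>k. k < g \<longrightarrow> \<not> has_cycle_len F k)"

definition Gprime :: "nat \<Rightarrow> nat \<Rightarrow> (nat \<times> nat) set set set" where
  "Gprime g n = {F \<in> pairings n. simple_proj F \<and> cubic_proj n F \<and> girth_ge F g}"

definition independent :: "nat \<Rightarrow> (nat \<times> nat) set set \<Rightarrow> nat set \<Rightarrow> bool" where
  "independent n F S \<longleftrightarrow> S \<subseteq> {1..n} \<and> (\<forall>u\<in>S. \<forall>v\<in>S. \<not> adj F u v)"

definition alpha :: "nat \<Rightarrow> (nat \<times> nat) set set \<Rightarrow> nat" where
  "alpha n F = Max {card S | S. independent n F S}"

end

theory Submission
  imports Defs
begin

text \<open>
  A one-step interpolation (1RSB) bound on $E[z^{\alpha}]$ for the configuration model, followed by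
  Markov's inequality.  To a partial matching of the points one adds random
  \<^emph>\<open>fields\<close>: unmatched points that are blocked with probability $q$.  The ground energy is the maximum over
  vertex sets $I$ of $|I|$ minus the number of matching edges inside $I$ and of blocked points over $I$; on a
  cubic graph without fields it is the independence number.  Since energies are integers, a new penalty lowers
  the ground energy by one exactly if it hits every maximiser.  So with $\kappa = 1 - 1/z$ and $c$ the fraction
  of free points lying over the intersection of all maximisers, a random field multiplies $z^{ground}$ by
  $1 - \kappa q c$ and a random edge by about
  $1 - \kappa c^2 \le (1 - \kappa q c)^2 / (1 - \kappa q^2)$, the last step being $(c - q)^2 \ge 0$.
  Trading two fields for one edge until everything is matched yields, up to subexponential factors,
  \[ E[z^{\alpha}] \le \bigl((1 + (z - 1)(1 - q)^3) (1 - \kappa q^2)^{-3/2}\bigr)^n, \]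
  and for $z = 3$, $q = 1/2$ the base is $\sqrt{27/10} < 3^{0.454}$.
\<close>

subsection \<open>Penalties and ground energies\<close>

text \<open>A singleton \<open>T\<close> encodes a blocked point, a doubleton an edge. A matched
  pair of points over one vertex gives a singleton, so loops need no separate treatment.\<close>

definition penalize :: "'v set \<Rightarrow> ('v set \<Rightarrow> int) \<Rightarrow> 'v set \<Rightarrow> int" where
  "penalize T J I = J I - of_bool (T \<subseteq> I)"

definition ground :: "'v set \<Rightarrow> ('v set \<Rightarrow> int) \<Rightarrow> int" where
  "ground V J = Max (J ` Pow V)"

definition core :: "'v set \<Rightarrow> ('v set \<Rightarrow> int) \<Rightarrow> 'v set" where
  "core V J = {v \<in> V. \<forall>I\<subseteq>V. J I = ground V J \<longrightarrow> v \<in> I}"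

lemma penalize_commute: "penalize S (penalize T J) = penalize T (penalize S J)"
  by (auto simp: penalize_def)

lemma ground_ge: "finite V \<Longrightarrow> I \<subseteq> V \<Longrightarrow> J I \<le> ground V J"
  by (simp add: ground_def)

lemma ground_attained: "finite V \<Longrightarrow> \<exists>I\<subseteq>V. J I = ground V J"
proof -
  assume "finite V"
  then have "Max (J ` Pow V) \<in> J ` Pow V" by (intro Max_in) auto
  then show ?thesis by (auto simp: ground_def)
qed

text \<open>Energies are integers: if \<open>T\<close> lies in every maximiser, all of these drop by
  one while the other sets were already at least one below; otherwise some maximiser escapes the
  penalty.\<close>

lemma ground_penalize:
  assumes "finite V"
  shows "ground V (penalize T J) = ground V J - of_bool (T \<subseteq> core V J)"
proof (cases "T \<subseteq> core V J")
  case True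
  obtain I where I: "I \<subseteq> V" "J I = ground V J"
    using ground_attained[OF assms] by blast
  have "Max (penalize T J ` Pow V) = ground V J - 1"
  proof (rule Max_eqI)
    show "finite (penalize T J ` Pow V)" using assms by simp
    show "ground V J - 1 \<in> penalize T J ` Pow V"
      using I True by (intro image_eqI[of _ _ I]) (auto simp: penalize_def core_def)
  next
    fix w assume "w \<in> penalize T J ` Pow V"
    then obtain K where K: "K \<subseteq> V" "w = penalize T J K" by auto
    show "w \<le> ground V J - 1"
      using K True ground_ge[OF assms K(1), of J]
      by (cases "J K = ground V J") (auto simp: penalize_def core_def)
  qed
  then show ?thesis using True by (simp add: ground_def)
next
  case False
  then obtain I where I: "I \<subseteq> V" "J I = ground V J" "\<not> T \<subseteq> I"
    using ground_attained[OF assms, of J] unfolding core_def by blast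
  have "Max (penalize T J ` Pow V) = ground V J"
  proof (rule Max_eqI)
    show "finite (penalize T J ` Pow V)" using assms by simp
    show "ground V J \<in> penalize T J ` Pow V"
      using I by (intro image_eqI[of _ _ I]) (auto simp: penalize_def)
  next
    fix w assume "w \<in> penalize T J ` Pow V"
    then obtain K where K: "K \<subseteq> V" "w = penalize T J K" by auto
    show "w \<le> ground V J"
      using K ground_ge[OF assms K(1), of J] by (auto simp: penalize_def)
  qed
  then show ?thesis using False by (simp add: ground_def)
qed

subsection \<open>Averaging over random edges and fields\<close>

type_synonym ('v, 'k) functional = "('v set \<Rightarrow> int) \<Rightarrow> ('v \<times> 'k) set \<Rightarrow> real"

text \<open>Transition operator of a random process whose state is an energy and the set of free
  points: \<open>\<Psi>\<close> is averaged over the state after one random step. In a composition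
  the outermost operator is the step performed first.\<close>

definition edge_avg :: "('v, 'k) functional \<Rightarrow> ('v, 'k) functional" where
  "edge_avg \<Psi> J R = (\<Sum>x\<in>R. \<Sum>y\<in>R - {x}. \<Psi> (penalize {fst x, fst y} J) (R - {x} - {y}))
     / (real (card R) * (real (card R) - 1))"

definition field_avg :: "real \<Rightarrow> ('v, 'k) functional \<Rightarrow> ('v, 'k) functional" where
  "field_avg q \<Psi> J R = (\<Sum>x\<in>R. (1 - q) * \<Psi> J (R - {x}) + q * \<Psi> (penalize {fst x} J) (R - {x}))
     / real (card R)"

lemma sum_distinct_triples_rotate:
  fixes h :: "'a \<Rightarrow> 'a \<Rightarrow> 'a \<Rightarrow> 'b::comm_monoid_add"
  assumes "finite R"
  shows "(\<Sum>x\<in>R. \<Sum>y\<in>R - {x}. \<Sum>w\<in>R - {x} - {y}. h x y w)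
       = (\<Sum>w\<in>R. \<Sum>x\<in>R - {w}. \<Sum>y\<in>R - {w} - {x}. h x y w)"
proof -
  \<comment> \<open>The inner ranges depend on the outer variables; turning them into indicators
    makes \<open>sum.swap\<close> applicable.\<close>
  have *: "(\<Sum>x\<in>A - {a}. g x) = (\<Sum>x\<in>A. if x \<noteq> a then g x else 0)" if "finite A" for A a and g :: "'a \<Rightarrow> 'b"
    using that by (intro sum.mono_neutral_cong_left) auto
  have "(\<Sum>x\<in>R. \<Sum>y\<in>R - {x}. \<Sum>w\<in>R - {x} - {y}. h x y w)
      = (\<Sum>x\<in>R. \<Sum>y\<in>R. \<Sum>w\<in>R. if x \<noteq> y \<and> x \<noteq> w \<and> y \<noteq> w then h x y w else 0)"
    using assms by (auto simp: * intro!: sum.cong sum.neutral)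
  also have "\<dots> = (\<Sum>x\<in>R. \<Sum>w\<in>R. \<Sum>y\<in>R. if x \<noteq> y \<and> x \<noteq> w \<and> y \<noteq> w then h x y w else 0)"
    by (intro sum.cong refl sum.swap)
  also have "\<dots> = (\<Sum>w\<in>R. \<Sum>x\<in>R. \<Sum>y\<in>R. if x \<noteq> y \<and> x \<noteq> w \<and> y \<noteq> w then h x y w else 0)"
    by (rule sum.swap)
  also have "\<dots> = (\<Sum>w\<in>R. \<Sum>x\<in>R - {w}. \<Sum>y\<in>R - {w} - {x}. h x y w)"
    using assms by (auto simp: * intro!: sum.cong sum.neutral)
  finally show ?thesis .
qed

text \<open>Either order draws three distinct points uniformly, with the same normalisation
  \<open>r * (r - 1) * (r - 2)\<close>, and the penalties commute.\<close>

lemma edge_field_commute: "edge_avg (field_avg q \<Psi>) = field_avg q (edge_avg \<Psi>)"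
proof (intro ext)
  fix J and R :: "('a \<times> 'b) set"
  show "edge_avg (field_avg q \<Psi>) J R = field_avg q (edge_avg \<Psi>) J R"
  proof (cases "finite R")
    \<comment> \<open>For infinite \<open>R\<close> both sides are 0, the default value of infinite
      sums and of division by 0.\<close>
    case False
    then show ?thesis by (simp add: edge_avg_def field_avg_def)
  next
    case True
    define r where "r = real (card R)"
    define h where "h x y w =
        (1 - q) * \<Psi> (penalize {fst x, fst y} J) (R - {x} - {y} - {w})
      + q * \<Psi> (penalize {fst w} (penalize {fst x, fst y} J)) (R - {x} - {y} - {w})" for x y w
    have c1: "real (card (A - {x})) = real (card A) - 1" if "finite A" "x \<in> A" for A :: "('a \<times> 'b) set" and x
      using card.remove[OF that] by simp
    have c2: "real (card (R - {x} - {y})) = r - 2" if "x \<in> R" "y \<in> R - {x}" for x y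
      using that True c1[of "R - {x}" y] c1[of R x] by (simp add: r_def del: card_Diff_insert card_Diff_singleton)
    have "edge_avg (field_avg q \<Psi>) J R
        = (\<Sum>x\<in>R. \<Sum>y\<in>R - {x}. (\<Sum>w\<in>R - {x} - {y}. h x y w) / (r - 2)) / (r * (r - 1))"
      unfolding edge_avg_def field_avg_def r_def[symmetric]
      by (intro arg_cong2[where f = "(/)"] sum.cong refl) (simp_all add: h_def c2 del: card_Diff_insert card_Diff_singleton)
    also have "\<dots> = (\<Sum>x\<in>R. \<Sum>y\<in>R - {x}. \<Sum>w\<in>R - {x} - {y}. h x y w) / (r * (r - 1) * (r - 2))"
      by (simp add: sum_divide_distrib[symmetric])
    also have "(\<Sum>x\<in>R. \<Sum>y\<in>R - {x}. \<Sum>w\<in>R - {x} - {y}. h x y w)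
        = (\<Sum>w\<in>R. \<Sum>x\<in>R - {w}. \<Sum>y\<in>R - {w} - {x}. h x y w)"
      by (rule sum_distinct_triples_rotate[OF True])
    also have "\<dots> / (r * (r - 1) * (r - 2))
        = (\<Sum>w\<in>R. (\<Sum>x\<in>R - {w}. \<Sum>y\<in>R - {w} - {x}. h x y w) / ((r - 1) * (r - 2))) / r"
      by (simp add: sum_divide_distrib[symmetric] mult_ac)
    also have "\<dots> = field_avg q (edge_avg \<Psi>) J R"
      unfolding edge_avg_def field_avg_def r_def[symmetric]
    proof (intro arg_cong2[where f = "(/)"] sum.cong refl)
      fix w assume w: "w \<in> R"
      have "(\<Sum>x\<in>R - {w}. \<Sum>y\<in>R - {w} - {x}. h x y w)
          = (1 - q) * (\<Sum>x\<in>R - {w}. \<Sum>y\<in>R - {w} - {x}. \<Psi> (penalize {fst x, fst y} J) (R - {w} - {x} - {y}))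
          + q * (\<Sum>x\<in>R - {w}. \<Sum>y\<in>R - {w} - {x}. \<Psi> (penalize {fst x, fst y} (penalize {fst w} J)) (R - {w} - {x} - {y}))"
        unfolding sum_distrib_left sum.distrib[symmetric] h_def
        by (intro sum.cong refl) (simp add: penalize_commute[of "{fst w}"] insert_commute Diff_insert2[symmetric] Diff_insert[symmetric])
      then show "(\<Sum>x\<in>R - {w}. \<Sum>y\<in>R - {w} - {x}. h x y w) / ((r - 1) * (r - 2))
        = (1 - q) * ((\<Sum>x\<in>R - {w}. \<Sum>y\<in>R - {w} - {x}. \<Psi> (penalize {fst x, fst y} J) (R - {w} - {x} - {y}))
              / (real (card (R - {w})) * (real (card (R - {w})) - 1)))
        + q * ((\<Sum>x\<in>R - {w}. \<Sum>y\<in>R - {w} - {x}. \<Psi> (penalize {fst x, fst y} (penalize {fst w} J)) (R - {w} - {x} - {y}))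
              / (real (card (R - {w})) * (real (card (R - {w})) - 1)))"
        by (simp add: c1[OF True w] r_def add_divide_distrib)
    qed
    finally show ?thesis .
  qed
qed

text \<open>Edge and field averages commute, so either kind of step can be regarded as the last one added.\<close>
definition mixed_avg :: "real \<Rightarrow> nat \<Rightarrow> nat \<Rightarrow> ('v, 'k) functional \<Rightarrow> ('v, 'k) functional" where
  "mixed_avg q t s \<Psi> = (edge_avg ^^ t) ((field_avg q ^^ s) \<Psi>)"

lemma mixed_avg_Suc_field: "mixed_avg q t (Suc s) \<Psi> = mixed_avg q t s (field_avg q \<Psi>)"
  by (simp add: mixed_avg_def funpow_swap1)

lemma mixed_avg_Suc_edge: "mixed_avg q (Suc t) s \<Psi> = mixed_avg q t s (edge_avg \<Psi>)"
proof -
  have "edge_avg ((field_avg q ^^ s) \<Psi>) = (field_avg q ^^ s) (edge_avg \<Psi>)"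
    by (induction s) (simp_all add: edge_field_commute)
  then show ?thesis by (simp add: mixed_avg_def funpow_swap1)
qed

section \<open>Linearity and monotonicity of the averages\<close>

lemma edge_avg_linear:
  "edge_avg (\<lambda>J R. a * \<Psi> J R + b * \<Phi> J R) = (\<lambda>J R. a * edge_avg \<Psi> J R + b * edge_avg \<Phi> J R)"
  by (simp add: edge_avg_def sum.distrib sum_distrib_left add_divide_distrib fun_eq_iff)

lemma field_avg_linear:
  "field_avg q (\<lambda>J R. a * \<Psi> J R + b * \<Phi> J R) = (\<lambda>J R. a * field_avg q \<Psi> J R + b * field_avg q \<Phi> J R)"
  unfolding field_avg_def times_divide_eq_right sum_distrib_left add_divide_distrib[symmetric] sum.distrib[symmetric]
  by (intro ext arg_cong2[where f = "(/)"] sum.cong refl) (simp add: algebra_simps)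

lemma mixed_avg_linear:
  "mixed_avg q t s (\<lambda>J R. a * \<Psi> J R + b * \<Phi> J R)
     = (\<lambda>J R. a * mixed_avg q t s \<Psi> J R + b * mixed_avg q t s \<Phi> J R)"
proof (induction s arbitrary: \<Psi> \<Phi>)
  case 0
  show ?case
    by (induction t arbitrary: \<Psi> \<Phi>) (simp_all add: mixed_avg_Suc_edge edge_avg_linear, simp add: mixed_avg_def)
next
  case (Suc s)
  then show ?case by (simp add: mixed_avg_Suc_field field_avg_linear)
qed

lemma edge_avg_mono:
  assumes "\<And>J R. card R = k \<Longrightarrow> \<Psi> J R \<le> \<Phi> J R" and "card R = k + 2"
  shows "edge_avg \<Psi> J R \<le> edge_avg \<Phi> J R"
proof -
  have "finite R" using assms(2) by (intro card_ge_0_finite) simp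
  then show ?thesis
    unfolding edge_avg_def using assms
    by (intro divide_right_mono sum_mono) (simp_all add: card_Diff_singleton)
qed

lemma field_avg_mono:
  assumes "\<And>J R. card R = k \<Longrightarrow> \<Psi> J R \<le> \<Phi> J R" and "card R = k + 1" "0 \<le> q" "q \<le> 1"
  shows "field_avg q \<Psi> J R \<le> field_avg q \<Phi> J R"
proof -
  have "finite R" using assms(2) by (intro card_ge_0_finite) simp
  then show ?thesis
    unfolding field_avg_def using assms
    by (intro divide_right_mono sum_mono add_mono mult_left_mono) (simp_all add: card_Diff_singleton)
qed

text \<open>Exactly \<open>k\<close> points are still free after all steps, so the functionals need
  to be compared only at that size.\<close>

lemma mixed_avg_mono:
  assumes q: "0 \<le> q" "q \<le> 1"
    and "\<And>J R. card R = k \<Longrightarrow> \<Psi> J R \<le> \<Phi> J R"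
    and "card R = k + 2 * t + s"
  shows "mixed_avg q t s \<Psi> J R \<le> mixed_avg q t s \<Phi> J R"
  using assms(3,4)
proof (induction s arbitrary: \<Psi> \<Phi> k)
  case 0
  then show ?case
  proof (induction t arbitrary: \<Psi> \<Phi> k)
    case 0
    then show ?case by (simp add: mixed_avg_def)
  next
    case (Suc t)
    show ?case
      unfolding mixed_avg_Suc_edge
      by (rule Suc.IH[of "k + 2"]) (use Suc.prems in \<open>auto intro!: edge_avg_mono[where k = k]\<close>)
  qed
next
  case (Suc s)
  show ?case
    unfolding mixed_avg_Suc_field
    by (rule Suc.IH[of "k + 1"]) (use Suc.prems q in \<open>auto intro!: field_avg_mono[where k = k]\<close>)
qed


text \<open>Transfers every pointwise bound below to averages. By linearity the coefficients may
  have any sign, which the edge bound relies on.\<close>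

lemma mixed_avg_weighted_mono:
  assumes "0 \<le> q" "q \<le> 1"
    and "\<And>J R. card R = k \<Longrightarrow> \<Psi> J R \<le> a * \<Phi>1 J R + b * \<Phi>2 J R"
    and "card R = k + 2 * t + s"
  shows "mixed_avg q t s \<Psi> J R \<le> a * mixed_avg q t s \<Phi>1 J R + b * mixed_avg q t s \<Phi>2 J R"
  using mixed_avg_mono[OF assms] by (simp add: mixed_avg_linear)

subsection \<open>Comparison of an edge with two fields\<close>

definition boltzmann :: "'v set \<Rightarrow> real \<Rightarrow> ('v, 'k) functional" where
  "boltzmann V z J R = z powi ground V J"

locale interpolation =
  fixes V :: "'v set" and q z :: real
  assumes finite_V: "finite V" and q: "0 < q" "q < 1" and z: "1 < z"
begin

text \<open>Relative loss of \<open>z powi ground V J\<close> when the ground energy falls by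
  one.\<close>

definition \<kappa> :: real where "\<kappa> = 1 - 1 / z"

lemma kappa: "0 < \<kappa>" "\<kappa> < 1"
  using z by (auto simp: \<kappa>_def)

lemma kappa_q_less_1: "\<kappa> * q < 1"
  using mult_strict_mono'[of \<kappa> 1 q 1] kappa q by simp

lemma boltzmann_pos: "0 < boltzmann V z J R"
  using z by (simp add: boltzmann_def)

lemma boltzmann_remaining: "boltzmann V z J (R - A) = boltzmann V z J R"
  by (simp add: boltzmann_def)

lemma boltzmann_penalize:
  "boltzmann V z (penalize T J) R = boltzmann V z J R * (1 - \<kappa> * of_bool (T \<subseteq> core V J))"
  using z by (simp add: boltzmann_def ground_penalize[OF finite_V] \<kappa>_def power_int_diff)

lemma field_avg_boltzmann:
  assumes "card R > 0"
  shows "field_avg q (boltzmann V z) J R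
    = boltzmann V z J R * (1 - \<kappa> * q * (real (card {x \<in> R. fst x \<in> core V J}) / real (card R)))"
proof -
  have fin: "finite R" using assms by (rule card_ge_0_finite)
  define m where "m = real (card {x \<in> R. fst x \<in> core V J})"
  have "(\<Sum>x\<in>R. (1 - q) * boltzmann V z J (R - {x}) + q * boltzmann V z (penalize {fst x} J) (R - {x}))
      = (\<Sum>x\<in>R. boltzmann V z J R * (1 - \<kappa> * q * of_bool (fst x \<in> core V J)))"
    by (intro sum.cong refl) (simp add: boltzmann_remaining boltzmann_penalize algebra_simps)
  also have "\<dots> = boltzmann V z J R * (real (card R) - \<kappa> * q * m)"
    using fin by (simp add: sum_distrib_left[symmetric] sum_subtractf m_def of_bool_def sum.If_cases Int_def)
  finally show ?thesis
    using assms by (simp add: field_avg_def m_def field_simps)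
qed

text \<open>The energy drops exactly when both ends lie over the core, which holds for
  \<open>m * (m - 1)\<close> of the \<open>r * (r - 1)\<close> ordered pairs.\<close>

lemma edge_avg_boltzmann:
  fixes J :: "'v set \<Rightarrow> int" and R :: "('v \<times> 'k) set"
  assumes "card R > 1"
  defines "m \<equiv> real (card {x \<in> R. fst x \<in> core V J})" and "r \<equiv> real (card R)"
  shows "edge_avg (boltzmann V z) J R
    = boltzmann V z J R * (1 - \<kappa> * (m * (m - 1) / (r * (r - 1))))"
proof -
  have fin: "finite R" using assms by (intro card_ge_0_finite) simp
  define B where "B = boltzmann V z J R"
  let ?C = "{x \<in> R. fst x \<in> core V J}"
  have "(\<Sum>x\<in>R. \<Sum>y\<in>R - {x}. boltzmann V z (penalize {fst x, fst y} J) (R - {x} - {y}))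
      = (\<Sum>x\<in>R. B * ((r - 1) - \<kappa> * ((m - 1) * of_bool (fst x \<in> core V J))))"
  proof (rule sum.cong[OF refl])
    fix x assume x: "x \<in> R"
    have r1: "real (card (R - {x})) = r - 1"
      using card.remove[OF fin x] by (simp add: r_def)
    have m1: "real (card {y \<in> R - {x}. fst y \<in> core V J}) = m - 1" if "fst x \<in> core V J"
    proof -
      have "{y \<in> R - {x}. fst y \<in> core V J} = ?C - {x}" by auto
      then show ?thesis using card.remove[of ?C x] fin x that by (simp add: m_def)
    qed
    have "(\<Sum>y\<in>R - {x}. boltzmann V z (penalize {fst x, fst y} J) (R - {x} - {y}))
        = (\<Sum>y\<in>R - {x}. B * (1 - \<kappa> * (of_bool (fst x \<in> core V J) * of_bool (fst y \<in> core V J))))"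
      by (intro sum.cong refl) (simp add: boltzmann_remaining boltzmann_penalize B_def)
    also have "\<dots> = B * ((r - 1) - \<kappa> * (of_bool (fst x \<in> core V J) * real (card {y \<in> R - {x}. fst y \<in> core V J})))"
      using fin r1 by (simp add: sum_distrib_left[symmetric] sum_subtractf of_bool_def sum.If_cases Int_def
          del: card_Diff_insert card_Diff_singleton)
    also have "\<dots> = B * ((r - 1) - \<kappa> * ((m - 1) * of_bool (fst x \<in> core V J)))"
      using m1 by auto
    finally show "(\<Sum>y\<in>R - {x}. boltzmann V z (penalize {fst x, fst y} J) (R - {x} - {y}))
      = B * ((r - 1) - \<kappa> * ((m - 1) * of_bool (fst x \<in> core V J)))" .
  qed
  also have "\<dots> = B * (r * (r - 1) - \<kappa> * (m * (m - 1)))"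
  proof -
    have "(\<Sum>x\<in>R. of_bool (fst x \<in> core V J)) = m"
      using fin by (simp add: m_def of_bool_def sum.If_cases Int_def)
    moreover have "(\<Sum>x\<in>R. r - 1) = r * (r - 1)" by (simp add: r_def)
    ultimately show ?thesis
      by (simp add: sum_distrib_left[symmetric] sum_subtractf mult.commute[of m])
  qed
  finally have *: "edge_avg (boltzmann V z) J R
      = B * (r * (r - 1) - \<kappa> * (m * (m - 1))) / (r * (r - 1))"
    by (simp add: edge_avg_def r_def)
  have "r * (r - 1) \<noteq> 0" using assms by (simp add: r_def)
  then show ?thesis unfolding * B_def by (simp add: field_simps)
qed

text \<open>Linear in the core density thanks to $c^2 \ge 2bc - b^2$, hence stable under averaging; the best $b$ is the
  averaged density, which is chosen only afterwards.\<close>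
lemma boltzmann_edge_vs_field:
  assumes "card R = k" "1 < k"
  shows "edge_avg (boltzmann V z) J R
    \<le> (1 + \<kappa> * b\<^sup>2 + \<kappa> / (real k - 1) - 2 * b / q) * boltzmann V z J R
      + (2 * b / q) * field_avg q (boltzmann V z) J R"
proof -
  have fin: "finite R" using assms by (intro card_ge_0_finite) simp
  define m where "m = real (card {x \<in> R. fst x \<in> core V J})"
  define r where "r = real k"
  define c where "c = m / r"
  have r: "1 < r" using assms by (simp add: r_def)
  have m: "0 \<le> m" "m \<le> r"
    using card_mono[OF fin, of "{x \<in> R. fst x \<in> core V J}"] assms by (auto simp: m_def r_def)
  \<comment> \<open>Price of drawing the two ends without replacement.\<close>
  have "c\<^sup>2 - m * (m - 1) / (r * (r - 1)) = (c * (1 - c)) / (r - 1)"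
    using r by (simp add: c_def field_simps power2_eq_square)
  also have "\<dots> \<le> 1 / (r - 1)"
    using m r by (intro divide_right_mono mult_le_one) (auto simp: c_def)
  finally have "2 * b * c - b\<^sup>2 - 1 / (r - 1) \<le> m * (m - 1) / (r * (r - 1))"
    using sum_squares_bound[of b c] by simp
  then have "\<kappa> * (2 * b * c - b\<^sup>2 - 1 / (r - 1)) \<le> \<kappa> * (m * (m - 1) / (r * (r - 1)))"
    using kappa by (intro mult_left_mono) auto
  then have "boltzmann V z J R * (1 - \<kappa> * (m * (m - 1) / (r * (r - 1))))
      \<le> boltzmann V z J R * (1 - \<kappa> * (2 * b * c - b\<^sup>2 - 1 / (r - 1)))"
    using boltzmann_pos[of J R] by (intro mult_left_mono) auto
  \<comment> \<open>The unknown density \<open>c\<close> is expressed through the loss caused by one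
    field, which is \<open>\<kappa> * q * c\<close>; hence the coefficient
    \<open>2 * b / q\<close>.\<close>
  also have "\<dots> = (1 + \<kappa> * b\<^sup>2 + \<kappa> / (r - 1) - 2 * b / q) * boltzmann V z J R
      + (2 * b / q) * (boltzmann V z J R * (1 - \<kappa> * q * c))"
    using q by (simp add: field_simps)
  finally show ?thesis
    using edge_avg_boltzmann[of R J] field_avg_boltzmann[of R J] assms
    by (simp add: m_def r_def c_def)
qed

text \<open>Expectation of \<open>z\<close> to the ground energy after adding \<open>t\<close>
  random edges and \<open>s\<close> random fields to \<open>J0\<close>.\<close>

definition partition_fn :: "('v set \<Rightarrow> int) \<Rightarrow> ('v \<times> 'k) set \<Rightarrow> nat \<Rightarrow> nat \<Rightarrow> real" where
  "partition_fn J0 P t s = mixed_avg q t s (boltzmann V z) J0 P"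

section \<open>One-step bounds on the partition function\<close>

lemma partition_fn_field_le:
  fixes P :: "('v \<times> 'k) set"
  assumes "2 * t + s < card P"
  shows "partition_fn J0 P t (Suc s) \<le> partition_fn J0 P t s"
proof -
  \<comment> \<open>The zero term brings the bound into the shape of
    \<open>mixed_avg_weighted_mono\<close>.\<close>
  have *: "field_avg q (boltzmann V z) J R \<le> 1 * boltzmann V z J R + 0 * boltzmann V z J R"
    if "card R = card P - 2 * t - s" for J and R :: "('v \<times> 'k) set"
    using that assms boltzmann_pos[of J R] kappa q by (subst field_avg_boltzmann) simp_all
  show ?thesis
  proof -
    have "mixed_avg q t s (field_avg q (boltzmann V z)) J0 P
        \<le> 1 * mixed_avg q t s (boltzmann V z) J0 P + 0 * mixed_avg q t s (boltzmann V z) J0 P"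
      by (rule mixed_avg_weighted_mono[OF _ _ *]) (use assms q in auto)
    then show ?thesis by (simp add: partition_fn_def mixed_avg_Suc_field)
  qed
qed

lemma partition_fn_field_ge:
  fixes P :: "('v \<times> 'k) set"
  assumes "2 * t + s < card P"
  shows "(1 - \<kappa> * q) * partition_fn J0 P t s \<le> partition_fn J0 P t (Suc s)"
proof -
  \<comment> \<open>Worst case of core density 1, solved for \<open>boltzmann\<close> so that it
    becomes an upper bound that can be averaged.\<close>
  have *: "boltzmann V z J R \<le> (1 / (1 - \<kappa> * q)) * field_avg q (boltzmann V z) J R + 0 * boltzmann V z J R"
    if R: "card R = card P - 2 * t - s" for J and R :: "('v \<times> 'k) set"
  proof -
    have "card R > 0" using R assms by simp
    then have "real (card {x \<in> R. fst x \<in> core V J}) / real (card R) \<le> 1"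
      using card_mono[of R "{x \<in> R. fst x \<in> core V J}"] card_ge_0_finite[of R] by auto
    then have "\<kappa> * q * (real (card {x \<in> R. fst x \<in> core V J}) / real (card R)) \<le> \<kappa> * q * 1"
      using kappa q by (intro mult_left_mono) auto
    then have "boltzmann V z J R * (1 - \<kappa> * q) \<le> field_avg q (boltzmann V z) J R"
      using boltzmann_pos[of J R] by (subst field_avg_boltzmann[OF \<open>card R > 0\<close>]) simp
    then show ?thesis using kappa_q_less_1 by (simp add: field_simps)
  qed
  have "mixed_avg q t s (boltzmann V z) J0 P
      \<le> (1 / (1 - \<kappa> * q)) * mixed_avg q t s (field_avg q (boltzmann V z)) J0 P
        + 0 * mixed_avg q t s (boltzmann V z) J0 P"
    by (rule mixed_avg_weighted_mono[OF _ _ *]) (use assms q in auto)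
  then show ?thesis
    using kappa_q_less_1 by (simp add: partition_fn_def mixed_avg_Suc_field field_simps)
qed

lemma partition_fn_edge_le:
  fixes P :: "('v \<times> 'k) set"
  assumes "2 * t + s + 1 < card P"
  shows "partition_fn J0 P (Suc t) s \<le> partition_fn J0 P t s"
proof -
  have *: "edge_avg (boltzmann V z) J R \<le> 1 * boltzmann V z J R + 0 * boltzmann V z J R"
    if R: "card R = card P - 2 * t - s" for J and R :: "('v \<times> 'k) set"
  proof -
    let ?m = "card {x \<in> R. fst x \<in> core V J}"
    have R1: "1 < card R" using R assms by simp
    then have "0 \<le> \<kappa> * (real ?m * (real ?m - 1) / (real (card R) * (real (card R) - 1)))"
      using kappa by (cases "?m") auto
    then have "boltzmann V z J R * (1 - \<kappa> * (real ?m * (real ?m - 1) / (real (card R) * (real (card R) - 1))))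
        \<le> boltzmann V z J R * 1"
      using boltzmann_pos[of J R] by (intro mult_left_mono) auto
    then show ?thesis
      by (simp add: edge_avg_boltzmann[OF R1])
  qed
  show ?thesis
  proof -
    have "mixed_avg q t s (edge_avg (boltzmann V z)) J0 P
        \<le> 1 * mixed_avg q t s (boltzmann V z) J0 P + 0 * mixed_avg q t s (boltzmann V z) J0 P"
      by (rule mixed_avg_weighted_mono[OF _ _ *]) (use assms q in auto)
    then show ?thesis by (simp add: partition_fn_def mixed_avg_Suc_edge)
  qed
qed

text \<open>A step multiplies the weight by at least \<open>1 - \<kappa>\<close> for an edge and
  \<open>1 - \<kappa> * q\<close> for a field. Positivity is what permits ratios and logarithms
  later.\<close>

lemma partition_fn_pos:
  fixes P :: "('v \<times> 'k) set"
  assumes "2 * t + s \<le> card P"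
  shows "0 < partition_fn J0 P t s"
proof -
  have k: "0 < 1 - \<kappa>" "0 < 1 - \<kappa> * q"
    using kappa kappa_q_less_1 by simp_all
  have *: "boltzmann V z J R \<le> (1 / (1 - \<kappa>)) * edge_avg (boltzmann V z) J R + 0 * boltzmann V z J R"
    if R: "card R > 1" for J and R :: "('v \<times> 'k) set"
  proof -
    let ?m = "card {x \<in> R. fst x \<in> core V J}"
    have "?m \<le> card R" using card_mono[of R "{x \<in> R. fst x \<in> core V J}"] R by (simp add: card_ge_0_finite)
    then have "real ?m * (real ?m - 1) \<le> real (card R) * (real (card R) - 1)"
      using R by (cases ?m) (auto intro!: mult_mono)
    then have "real ?m * (real ?m - 1) / (real (card R) * (real (card R) - 1)) \<le> 1"
      using R by simp
    then have "\<kappa> * (real ?m * (real ?m - 1) / (real (card R) * (real (card R) - 1))) \<le> \<kappa> * 1"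
      using kappa by (intro mult_left_mono) auto
    then have "boltzmann V z J R * (1 - \<kappa>) \<le> edge_avg (boltzmann V z) J R"
      using boltzmann_pos[of J R] by (subst edge_avg_boltzmann[OF R]) simp
    then show ?thesis using k by (simp add: field_simps)
  qed
  show ?thesis using assms
  proof (induction s)
    case 0
    then show ?case
    proof (induction t)
      case 0
      then show ?case using boltzmann_pos by (simp add: partition_fn_def mixed_avg_def)
    next
      case (Suc t)
      have "partition_fn J0 P t 0 \<le> 1 / (1 - \<kappa>) * partition_fn J0 P (Suc t) 0 + 0 * partition_fn J0 P t 0"
        unfolding partition_fn_def mixed_avg_Suc_edge
        by (rule mixed_avg_weighted_mono[where k = "card P - 2 * t"]) (use * Suc.prems q in auto)
      then have "(1 - \<kappa>) * partition_fn J0 P t 0 \<le> partition_fn J0 P (Suc t) 0"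
        using k by (simp add: field_simps)
      moreover have "0 < (1 - \<kappa>) * partition_fn J0 P t 0" using Suc k by simp
      ultimately show ?case by linarith
    qed
  next
    case (Suc s)
    then have "0 < (1 - \<kappa> * q) * partition_fn J0 P t s" using k by simp
    also have "\<dots> \<le> partition_fn J0 P t (Suc s)"
      using Suc by (intro partition_fn_field_ge) simp
    finally show ?case .
  qed
qed

text \<open>The heart of the interpolation: up to an error from having finitely many free points, an
  edge costs at least as much as two copies of the next field, after the correction
  \<open>1 - \<kappa> * q\<^sup>2\<close>.\<close>

lemma partition_fn_edge_vs_field:
  fixes P :: "('v \<times> 'k) set"
  assumes "2 * t + s + k \<le> card P" "1 < k"
  shows "partition_fn J0 P (Suc t) s * partition_fn J0 P t s * (1 - \<kappa> * q\<^sup>2)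
    \<le> (1 + (z - 1) / (real k - 1)) * (partition_fn J0 P t (Suc s))\<^sup>2"
proof -
  define F where "F = partition_fn J0 P t s"
  define \<rho> where "\<rho> = partition_fn J0 P t (Suc s) / F"
  \<comment> \<open>The averaged core density, read off from the field ratio via
    \<open>\<rho> = 1 - \<kappa> * q * b\<close>.\<close>
  define b where "b = (1 - \<rho>) / (\<kappa> * q)"
  define \<eta> where "\<eta> = \<kappa> / (real k - 1)"
  have F: "0 < F" unfolding F_def using assms by (intro partition_fn_pos) simp
  have \<rho>: "1 - \<kappa> * q \<le> \<rho>" "\<rho> \<le> 1"
    using partition_fn_field_le[of t s P J0] partition_fn_field_ge[of t s P J0] assms F
    by (simp_all add: \<rho>_def F_def[symmetric] field_simps)
  have kq: "0 < \<kappa> * q" using kappa q by simp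
  have b: "0 \<le> b" "b \<le> 1" using \<rho> kq by (simp_all add: b_def field_simps)
  have \<rho>b: "\<rho> = 1 - \<kappa> * q * b" using kappa q by (simp add: b_def)
  have *: "edge_avg (boltzmann V z) J R
      \<le> (1 + \<kappa> * b\<^sup>2 + \<eta> - 2 * b / q) * boltzmann V z J R + (2 * b / q) * field_avg q (boltzmann V z) J R"
    if R: "card R = card P - 2 * t - s" for J and R :: "('v \<times> 'k) set"
  proof -
    have "k \<le> card R" using R assms by simp
    then have "\<kappa> / (real (card R) - 1) \<le> \<eta>"
      unfolding \<eta>_def using assms kappa by (intro divide_left_mono) auto
    then have "(1 + \<kappa> * b\<^sup>2 + \<kappa> / (real (card R) - 1) - 2 * b / q) * boltzmann V z J R
      \<le> (1 + \<kappa> * b\<^sup>2 + \<eta> - 2 * b / q) * boltzmann V z J R"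
      using boltzmann_pos[of J R] by (intro mult_right_mono) auto
    then show ?thesis
      using boltzmann_edge_vs_field[OF refl, of R J b] \<open>k \<le> card R\<close> assms by linarith
  qed
  have "partition_fn J0 P (Suc t) s
      \<le> (1 + \<kappa> * b\<^sup>2 + \<eta> - 2 * b / q) * F + (2 * b / q) * partition_fn J0 P t (Suc s)"
    unfolding partition_fn_def F_def mixed_avg_Suc_edge mixed_avg_Suc_field
    by (rule mixed_avg_weighted_mono[OF _ _ *]) (use assms q in auto)
  also have "partition_fn J0 P t (Suc s) = F * (1 - \<kappa> * q * b)"
    using F \<rho>b by (simp add: \<rho>_def field_simps)
  also have "(1 + \<kappa> * b\<^sup>2 + \<eta> - 2 * b / q) * F + (2 * b / q) * (F * (1 - \<kappa> * q * b))
      = F * (1 - \<kappa> * b\<^sup>2 + \<eta>)"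
    using q by (simp add: field_simps power2_eq_square)
  \<comment> \<open>The additive error becomes a factor, since
    \<open>1 - \<kappa> * b\<^sup>2\<close> is at least \<open>1 / z\<close> and
    \<open>\<kappa> * z = z - 1\<close>.\<close>
  also have "\<dots> \<le> F * ((1 - \<kappa> * b\<^sup>2) * (1 + (z - 1) / (real k - 1)))"
  proof -
    have "b\<^sup>2 \<le> 1" using b by (simp add: power_le_one)
    then have "\<kappa> * b\<^sup>2 \<le> \<kappa> * 1" using kappa by (intro mult_left_mono) auto
    then have "1 / z \<le> 1 - \<kappa> * b\<^sup>2" by (simp add: \<kappa>_def)
    then have "(1 / z) * ((z - 1) / (real k - 1)) \<le> (1 - \<kappa> * b\<^sup>2) * ((z - 1) / (real k - 1))"
      using z assms by (intro mult_right_mono) auto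
    moreover have "(1 / z) * ((z - 1) / (real k - 1)) = \<eta>"
      using z by (simp add: \<eta>_def \<kappa>_def field_simps)
    ultimately show ?thesis using F by (intro mult_left_mono) (auto simp: algebra_simps)
  qed
  finally have "partition_fn J0 P (Suc t) s \<le> F * ((1 - \<kappa> * b\<^sup>2) * (1 + (z - 1) / (real k - 1)))" .
  moreover have "0 \<le> F * (1 - \<kappa> * q\<^sup>2)"
    using F kappa q by (simp add: mult_le_one power_le_one)
  ultimately have "partition_fn J0 P (Suc t) s * (F * (1 - \<kappa> * q\<^sup>2))
      \<le> F * ((1 - \<kappa> * b\<^sup>2) * (1 + (z - 1) / (real k - 1))) * (F * (1 - \<kappa> * q\<^sup>2))"
    by (rule mult_right_mono)
  also have "\<dots> = ((1 - \<kappa> * b\<^sup>2) * (1 - \<kappa> * q\<^sup>2)) * (F\<^sup>2 * (1 + (z - 1) / (real k - 1)))"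
    by (simp add: power2_eq_square)
  also have "\<dots> \<le> \<rho>\<^sup>2 * (F\<^sup>2 * (1 + (z - 1) / (real k - 1)))"
  proof (rule mult_right_mono)
    \<comment> \<open>Eliminates the unknown density: the defect is a square that vanishes at
      \<open>b = q\<close>.\<close>
    have "\<rho>\<^sup>2 - (1 - \<kappa> * b\<^sup>2) * (1 - \<kappa> * q\<^sup>2) = \<kappa> * (b - q)\<^sup>2"
      unfolding \<rho>b by (simp add: power2_eq_square algebra_simps)
    also have "\<dots> \<ge> 0" using kappa by simp
    finally show "(1 - \<kappa> * b\<^sup>2) * (1 - \<kappa> * q\<^sup>2) \<le> \<rho>\<^sup>2" by simp
    show "0 \<le> F\<^sup>2 * (1 + (z - 1) / (real k - 1))" using z assms by simp
  qed
  also have "\<dots> = (1 + (z - 1) / (real k - 1)) * (partition_fn J0 P t (Suc s))\<^sup>2"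
    using F by (simp add: \<rho>_def power_divide)
  finally show ?thesis by (simp add: F_def mult_ac)
qed

end

subsection \<open>Interpolation\<close>

text \<open>The hypothesis trades an edge for twice the \<^emph>\<open>first\<close> field increment, not for two consecutive ones.
  Averaging over a window of $L$ values of $s$ makes the discrepancy telescope, at cost $y / L$ per step.\<close>
lemma interpolation_window:
  fixes f :: "nat \<Rightarrow> nat \<Rightarrow> real"
  assumes step: "\<And>t s. 2 * t + s + L \<le> N \<Longrightarrow> f (Suc t) s + f t s \<le> 2 * f t (Suc s) + c"
    and lower: "\<And>t s. 2 * t + s < N \<Longrightarrow> f t s - y \<le> f t (Suc s)"
    and upper: "\<And>t s. 2 * t + s < N \<Longrightarrow> f t (Suc s) \<le> f t s"
    and N: "N = 2 * (T + L)" and L: "0 < L" and y: "0 \<le> y"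
  shows "f T 0 \<le> f 0 (2 * T) + real T * (c + y / real L) + real L * y"
proof -
  define W where "W t s = (\<Sum>j<L. f t (s + j))" for t s
  have shift: "W t (Suc s) = W t s + f t (s + L) - f t s" for t s
    using sum.lessThan_Suc_shift[of "\<lambda>j. f t (s + j)" L] by (simp add: W_def)
  \<comment> \<open>The second difference of \<open>W t\<close> telescopes to the increment of
    \<open>f t\<close> at \<open>s + L\<close> minus the one at \<open>s\<close>. The former is at
    least \<open>- y\<close>, the latter at most 0.\<close>
  have W_step: "W (Suc t) s \<le> W t (Suc (Suc s)) + real L * c + y" if ts: "2 * t + s + 2 = 2 * T" for t s
  proof -
    have "W (Suc t) s + W t s = (\<Sum>j<L. f (Suc t) (s + j) + f t (s + j))"
      by (simp add: W_def sum.distrib)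
    also have "\<dots> \<le> (\<Sum>j<L. 2 * f t (Suc (s + j)) + c)"
      using ts N by (intro sum_mono step) simp
    also have "\<dots> = 2 * W t (Suc s) + real L * c"
      by (simp add: W_def sum.distrib sum_distrib_left)
    finally have "W (Suc t) s \<le> 2 * W t (Suc s) - W t s + real L * c" by simp
    moreover have "W t (Suc (Suc s)) = W t (Suc s) + f t (Suc (s + L)) - f t (Suc s)"
      using shift[of t "Suc s"] by simp
    moreover have "f t (s + L) - y \<le> f t (Suc (s + L))" "f t (Suc s) \<le> f t s"
      using ts N L by (auto intro!: lower upper)
    ultimately show ?thesis using shift[of t s] by simp
  qed
  \<comment> \<open>Two fields are traded for one edge at a time along the line
    \<open>2 * t + s = 2 * T\<close>.\<close>
  have "W t (2 * (T - t)) \<le> W 0 (2 * T) + real t * (real L * c + y)" if "t \<le> T" for t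
    using that
  proof (induction t)
    case (Suc t)
    have "W (Suc t) (2 * (T - Suc t)) \<le> W t (2 * (T - t)) + real L * c + y"
    proof -
      have "2 * (T - t) = Suc (Suc (2 * (T - Suc t)))" using Suc.prems by simp
      then show ?thesis using W_step[of t "2 * (T - Suc t)"] Suc.prems by simp
    qed
    then show ?case using Suc by (simp add: algebra_simps)
  qed simp
  from this[of T] have WT: "W T 0 \<le> W 0 (2 * T) + real T * (real L * c + y)" by simp
  have below: "f t s - real j * y \<le> f t (s + j)" if "2 * t + s + j \<le> N" for t s j
    using that
  proof (induction j)
    case (Suc j)
    then show ?case using lower[of t "s + j"] by (simp add: algebra_simps)
  qed simp
  have above: "f t (s + j) \<le> f t s" if "2 * t + s + j \<le> N" for t s j
    using that
  proof (induction j)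
    case (Suc j)
    then show ?case using upper[of t "s + j"] by simp
  qed simp
  \<comment> \<open>Windows are exchanged for single values at both ends; the total drop over a
    window is at most \<open>real L * y\<close>.\<close>
  have "real L * (f T 0 - real L * y) = (\<Sum>j<L. f T 0 - real L * y)" by simp
  also have "\<dots> \<le> W T 0"
    unfolding W_def
  proof (rule sum_mono)
    fix j assume "j \<in> {..<L}"
    then have "real j * y \<le> real L * y" using y by (intro mult_right_mono) auto
    then show "f T 0 - real L * y \<le> f T (0 + j)"
      using below[of T 0 j] \<open>j \<in> {..<L}\<close> N by simp
  qed
  also note WT
  also have "W 0 (2 * T) \<le> (\<Sum>j<L. f 0 (2 * T))"
    unfolding W_def using N by (intro sum_mono above) simp
  finally have "real L * (f T 0 - real L * y) \<le> real L * (f 0 (2 * T)) + real T * (real L * c + y)"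
    by simp
  also have "\<dots> = real L * (f 0 (2 * T) + real T * (c + y / real L))"
    using L by (simp add: field_simps)
  finally show ?thesis using L by simp
qed

text \<open>Only \<open>T\<close> of the \<open>T + L\<close> edges are traded, so at least
  \<open>L\<close> points are free at each comparison. The last \<open>L\<close> edges only lower
  the value. In \<open>3 * real L * ln z\<close>, one share of \<open>real L * ln z\<close> comes
  from the window and two from the \<open>2 * L\<close> remaining fields.\<close>

lemma (in interpolation) partition_fn_interpolation:
  assumes P: "card P = 2 * (T + L)" and L: "1 < L"
  shows "ln (partition_fn J0 P (T + L) 0) \<le> ln (partition_fn J0 P 0 (card P))
    + real T * (ln (1 + (z - 1) / (real L - 1)) - ln (1 - \<kappa> * q\<^sup>2) + ln z / real L) + 3 * real L * ln z"
proof -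
  define f where "f t s = ln (partition_fn J0 P t s)" for t s
  define c where "c = ln (1 + (z - 1) / (real L - 1)) - ln (1 - \<kappa> * q\<^sup>2)"
  have pos: "0 < partition_fn J0 P t s" if "2 * t + s \<le> card P" for t s
    using partition_fn_pos that .
  have "q\<^sup>2 \<le> 1" using q by (simp add: power_le_one)
  then have "\<kappa> * q\<^sup>2 \<le> \<kappa> * 1" using kappa(1) by (intro mult_left_mono) auto
  then have D: "0 < 1 - \<kappa> * q\<^sup>2" using kappa(2) by linarith
  have K: "0 < 1 + (z - 1) / (real L - 1)" using z L by (simp add: add_pos_nonneg)
  have step: "f (Suc t) s + f t s \<le> 2 * f t (Suc s) + c" if "2 * t + s + L \<le> card P" for t s
  proof -
    have p: "0 < partition_fn J0 P (Suc t) s" "0 < partition_fn J0 P t s" "0 < partition_fn J0 P t (Suc s)"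
      using that L by (auto intro!: pos)
    have "ln (partition_fn J0 P (Suc t) s * partition_fn J0 P t s * (1 - \<kappa> * q\<^sup>2))
        \<le> ln ((1 + (z - 1) / (real L - 1)) * (partition_fn J0 P t (Suc s))\<^sup>2)"
      using partition_fn_edge_vs_field[OF that L] p D K by (subst ln_le_cancel_iff) auto
    then show ?thesis
      using p D K by (simp add: f_def c_def ln_mult ln_realpow)
  qed
  have lower: "f t s - ln z \<le> f t (Suc s)" if "2 * t + s < card P" for t s
  proof -
    have p: "0 < partition_fn J0 P t s" "0 < partition_fn J0 P t (Suc s)" using that by (auto intro!: pos)
    \<comment> \<open>A field costs at most a factor \<open>1 / z\<close>, so
      \<open>y = ln z\<close> serves in the window argument.\<close>
    have "\<kappa> * q \<le> \<kappa> * 1" using kappa q by (intro mult_left_mono) auto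
    then have "1 / z \<le> 1 - \<kappa> * q" by (simp add: \<kappa>_def)
    then have "1 / z * partition_fn J0 P t s \<le> (1 - \<kappa> * q) * partition_fn J0 P t s"
      using p by (intro mult_right_mono) auto
    also note partition_fn_field_ge[OF that]
    finally have "ln (partition_fn J0 P t s / z) \<le> ln (partition_fn J0 P t (Suc s))"
      using p z by (subst ln_le_cancel_iff) auto
    then show ?thesis using p z by (simp add: f_def ln_div)
  qed
  have upper: "f t (Suc s) \<le> f t s" if "2 * t + s < card P" for t s
    using partition_fn_field_le[OF that, of J0] pos[of t s] pos[of t "Suc s"] that by (simp add: f_def)
  have window: "f T 0 \<le> f 0 (2 * T) + real T * (c + ln z / real L) + real L * ln z"
    by (rule interpolation_window[where f = f, OF step lower upper P]) (use L z in auto)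
  have edges: "f (T + j) 0 \<le> f T 0" if "j \<le> L" for j
    using that
  proof (induction j)
    case (Suc j)
    have "f (Suc (T + j)) 0 \<le> f (T + j) 0"
      using partition_fn_edge_le[of "T + j" 0 P J0] pos[of "T + j" 0] pos[of "Suc (T + j)" 0] Suc.prems P
      by (simp add: f_def)
    then show ?case using Suc by simp
  qed simp
  have fields: "f 0 (2 * T) \<le> f 0 (2 * T + j) + real j * ln z" if "j \<le> 2 * L" for j
    using that
  proof (induction j)
    case (Suc j)
    then show ?case using lower[of 0 "2 * T + j"] P by (simp add: algebra_simps)
  qed simp
  show ?thesis
    using window edges[of L] fields[of "2 * L"] P by (simp add: f_def c_def algebra_simps)
qed

subsection \<open>The endpoint with fields only\<close>

lemma sum_Pow_binomial_weight:
  fixes q :: real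
  assumes "finite A"
  shows "(\<Sum>U\<in>Pow A. q ^ card U * (1 - q) ^ card (A - U)) = 1"
  using prod_add[OF assms, of "\<lambda>_. q" "\<lambda>_. 1 - q"] by simp

definition penalize_points :: "('v \<times> 'k) set \<Rightarrow> ('v set \<Rightarrow> int) \<Rightarrow> 'v set \<Rightarrow> int" where
  "penalize_points U J I = J I - int (card {x \<in> U. fst x \<in> I})"

text \<open>Once every point has received a field, the random order has no effect: each point is
  blocked independently with probability \<open>q\<close>. The sum splits over the status of any one
  point \<open>x\<close>, so the induction averages a constant over \<open>x\<close>.\<close>

lemma field_avg_exhaust:
  fixes R :: "('v \<times> 'k) set"
  assumes "finite R"
  shows "(field_avg q ^^ card R) \<Psi> J R
    = (\<Sum>U\<in>Pow R. q ^ card U * (1 - q) ^ card (R - U) * \<Psi> (penalize_points U J) {})"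
proof -
  define G where "G J R = (\<Sum>U\<in>Pow R. q ^ card U * (1 - q) ^ card (R - U) * \<Psi> (penalize_points U J) {})" for J and R :: "('v \<times> 'k) set"
  have G_split: "(1 - q) * G J (R - {x}) + q * G (penalize {fst x} J) (R - {x}) = G J R"
    if R: "finite R" "x \<in> R" for J and R :: "('v \<times> 'k) set" and x
  proof -
    let ?w = "\<lambda>U. q ^ card U * (1 - q) ^ card (R - U) * \<Psi> (penalize_points U J) {}"
    define S where "S = R - {x}"
    have S: "finite S" "x \<notin> S" "R = insert x S" using R by (auto simp: S_def)
    have fin: "finite U" if "U \<in> Pow S" for U using that S(1) finite_subset by auto
    have "G J R = (\<Sum>U\<in>Pow S. ?w U) + (\<Sum>U\<in>insert x ` Pow S. ?w U)"
      unfolding G_def S(3) Pow_insert using S by (intro sum.union_disjoint) auto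
    also have "(\<Sum>U\<in>insert x ` Pow S. ?w U) = (\<Sum>U\<in>Pow S. ?w (insert x U))"
    proof (rule sum.reindex[unfolded o_def])
      show "inj_on (insert x) (Pow S)"
      proof (rule inj_onI)
        fix A B assume "A \<in> Pow S" "B \<in> Pow S" "insert x A = insert x B"
        moreover from this have "x \<notin> A" "x \<notin> B" using S(2) by auto
        ultimately show "A = B" by (simp add: insert_ident)
      qed
    qed
    also have "(\<Sum>U\<in>Pow S. ?w (insert x U)) = q * G (penalize {fst x} J) S"
      unfolding G_def sum_distrib_left
    proof (rule sum.cong[OF refl])
      fix U assume U: "U \<in> Pow S"
      then have x: "x \<notin> U" using S by auto
      have "penalize_points (insert x U) J = penalize_points U (penalize {fst x} J)"
      proof
        fix I
        have "{y \<in> insert x U. fst y \<in> I} = (if fst x \<in> I then insert x {y \<in> U. fst y \<in> I} else {y \<in> U. fst y \<in> I})"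
          by auto
        then show "penalize_points (insert x U) J I = penalize_points U (penalize {fst x} J) I"
          using fin[OF U] x by (simp add: penalize_points_def penalize_def)
      qed
      moreover have "insert x S - insert x U = S - U" using S by auto
      ultimately show "?w (insert x U) = q * (q ^ card U * (1 - q) ^ card (S - U)
          * \<Psi> (penalize_points U (penalize {fst x} J)) {})"
        using fin[OF U] x S by simp
    qed
    also have "(\<Sum>U\<in>Pow S. ?w U) = (1 - q) * G J S"
      unfolding G_def sum_distrib_left
    proof (rule sum.cong[OF refl])
      fix U assume U: "U \<in> Pow S"
      then have "insert x S - U = insert x (S - U)" using S by auto
      then show "?w U = (1 - q) * (q ^ card U * (1 - q) ^ card (S - U) * \<Psi> (penalize_points U J) {})"
        using S by simp
    qed
    finally show ?thesis by (simp add: S_def)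
  qed
  have "(field_avg q ^^ n) \<Psi> J R = G J R" if "finite R" "card R = n" for n J and R :: "('v \<times> 'k) set"
    using that
  proof (induction n arbitrary: J R)
    case 0
    moreover have "penalize_points ({} :: ('v \<times> 'k) set) J = J" by (simp add: penalize_points_def fun_eq_iff)
    ultimately show ?case by (simp add: G_def)
  next
    case (Suc n)
    have "(field_avg q ^^ Suc n) \<Psi> J R
        = (\<Sum>x\<in>R. (1 - q) * G J (R - {x}) + q * G (penalize {fst x} J) (R - {x})) / real (card R)"
      unfolding funpow.simps o_def field_avg_def[of q "(field_avg q ^^ n) \<Psi>"]
      using Suc by (intro arg_cong2[where f = "(/)"] sum.cong refl) simp_all
    also have "\<dots> = G J R"
      using Suc.prems by (simp add: G_split)
    finally show ?case .
  qed
  from this[OF assms refl] show ?thesis by (simp add: G_def)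
qed

text \<open>A vertex of \<open>I\<close> with a blocked point gains one and pays at least one, so
  only vertices without blocked points can contribute.\<close>

lemma ground_penalize_points_card_le:
  assumes "finite V" "finite U"
  shows "ground V (penalize_points U (\<lambda>I. int (card I))) \<le> int (card {v \<in> V. v \<notin> fst ` U})"
proof -
  have "penalize_points U (\<lambda>I. int (card I)) I \<le> int (card {v \<in> V. v \<notin> fst ` U})" if I: "I \<subseteq> V" for I
  proof -
    have fin: "finite I" using I assms(1) finite_subset by blast
    have "card I = card (I \<inter> fst ` U) + card (I - fst ` U)"
      using fin by (metis card_Int_Diff)
    moreover have "card (I \<inter> fst ` U) \<le> card {x \<in> U. fst x \<in> I}"
    proof -
      have "I \<inter> fst ` U = fst ` {x \<in> U. fst x \<in> I}" by auto
      then show ?thesis using assms(2) by (simp add: card_image_le)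
    qed
    moreover have "card (I - fst ` U) \<le> card {v \<in> V. v \<notin> fst ` U}"
      using I assms(1) by (intro card_mono) auto
    ultimately show ?thesis by (simp add: penalize_points_def)
  qed
  then show ?thesis
    using assms(1) unfolding ground_def by (subst Max_le_iff) auto
qed

text \<open>Vertices are independent, and each has no blocked point with probability
  \<open>(1 - q) ^ card K\<close>, in which case it contributes \<open>z\<close> instead of
  1.\<close>

lemma (in interpolation) partition_fn_all_fields_le:
  assumes "finite K"
  shows "partition_fn (\<lambda>I. int (card I)) (V \<times> K) 0 (card (V \<times> K))
    \<le> (1 + (z - 1) * (1 - q) ^ card K) ^ card V"
proof -
  let ?P = "V \<times> K"
  let ?w = "\<lambda>U. q ^ card U * (1 - q) ^ card (?P - U)"
  have fP: "finite ?P" using finite_V assms by simp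
  \<comment> \<open>Expanding \<open>z = (z - 1) + 1\<close> reduces the expectation to the
    probabilities that all vertices of a set \<open>S\<close> are unblocked.\<close>
  have power_expand: "z ^ card {v \<in> V. v \<notin> fst ` U} = (\<Sum>S\<in>Pow V. (z - 1) ^ card S * of_bool (S \<inter> fst ` U = {}))" for U :: "('v \<times> 'k) set"
  proof -
    have fin: "finite {v \<in> V. v \<notin> fst ` U}" using finite_V by simp
    have "z ^ card {v \<in> V. v \<notin> fst ` U} = (\<Prod>v\<in>{v \<in> V. v \<notin> fst ` U}. (z - 1) + 1)" by simp
    also have "\<dots> = (\<Sum>S\<in>Pow {v \<in> V. v \<notin> fst ` U}. (z - 1) ^ card S)"
      by (subst prod_add[OF fin]) simp
    also have "\<dots> = (\<Sum>S\<in>Pow V. (z - 1) ^ card S * of_bool (S \<inter> fst ` U = {}))"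
      using finite_V by (intro sum.mono_neutral_cong_left) auto
    finally show ?thesis .
  qed
  \<comment> \<open>The points over \<open>S\<close> must all be unblocked; the weights of the other
    points sum to 1.\<close>
  have inner: "(\<Sum>U\<in>Pow ?P. ?w U * of_bool (S \<inter> fst ` U = {})) = (1 - q) ^ (card S * card K)"
    if S: "S \<in> Pow V" for S
  proof -
    let ?Q = "(V - S) \<times> K"
    have "(\<Sum>U\<in>Pow ?P. ?w U * of_bool (S \<inter> fst ` U = {})) = (\<Sum>U\<in>Pow ?Q. (1 - q) ^ (card S * card K) * (q ^ card U * (1 - q) ^ card (?Q - U)))"
    proof (rule sum.mono_neutral_cong_right)
      show "finite (Pow ?P)" using fP by simp
      show "Pow ?Q \<subseteq> Pow ?P" by auto
      show "\<forall>U\<in>Pow ?P - Pow ?Q. ?w U * of_bool (S \<inter> fst ` U = {}) = 0" by force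
      fix U assume U: "U \<in> Pow ?Q"
      have "?P - U = (S \<times> K) \<union> (?Q - U)" "(S \<times> K) \<inter> (?Q - U) = {}" using S U by auto
      moreover have "finite S" "finite ?Q" using S finite_V assms finite_subset by auto
      ultimately have "card (?P - U) = card S * card K + card (?Q - U)"
        using assms by (simp add: card_Un_disjoint card_cartesian_product)
      moreover have "S \<inter> fst ` U = {}" using U by auto
      ultimately show "?w U * of_bool (S \<inter> fst ` U = {}) = (1 - q) ^ (card S * card K) * (q ^ card U * (1 - q) ^ card (?Q - U))"
        by (simp add: power_add)
    qed
    also have "\<dots> = (1 - q) ^ (card S * card K)"
      using finite_V assms by (simp add: sum_distrib_left[symmetric] sum_Pow_binomial_weight)
    finally show ?thesis .
  qed
  have "partition_fn (\<lambda>I. int (card I)) ?P 0 (card ?P)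
      = (\<Sum>U\<in>Pow ?P. ?w U * z powi ground V (penalize_points U (\<lambda>I. int (card I))))"
    by (simp add: partition_fn_def mixed_avg_def field_avg_exhaust[OF fP] boltzmann_def)
  also have "\<dots> \<le> (\<Sum>U\<in>Pow ?P. ?w U * z ^ card {v \<in> V. v \<notin> fst ` U})"
  proof (intro sum_mono mult_left_mono)
    fix U assume "U \<in> Pow ?P"
    then have "finite U" using fP finite_subset by blast
    from ground_penalize_points_card_le[OF finite_V this]
    show "z powi ground V (penalize_points U (\<lambda>I. int (card I))) \<le> z ^ card {v \<in> V. v \<notin> fst ` U}"
      using z power_int_increasing[of _ "int (card {v \<in> V. v \<notin> fst ` U})" z] by simp
  qed (use q in simp)
  also have "\<dots> = (\<Sum>U\<in>Pow ?P. \<Sum>S\<in>Pow V. (z - 1) ^ card S * (?w U * of_bool (S \<inter> fst ` U = {})))"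
    by (simp add: power_expand sum_distrib_left mult_ac)
  also have "\<dots> = (\<Sum>S\<in>Pow V. (z - 1) ^ card S * (\<Sum>U\<in>Pow ?P. ?w U * of_bool (S \<inter> fst ` U = {})))"
    by (subst sum.swap) (simp add: sum_distrib_left)
  also have "\<dots> = (\<Sum>S\<in>Pow V. ((z - 1) * (1 - q) ^ card K) ^ card S)"
    by (intro sum.cong refl) (subst inner, simp_all add: power_mult_distrib power_mult[symmetric] mult.commute)
  also have "\<dots> = (1 + (z - 1) * (1 - q) ^ card K) ^ card V"
    using prod_add[OF finite_V, of "\<lambda>_. (z - 1) * (1 - q) ^ card K" "\<lambda>_. 1"] by (simp add: add.commute)
  finally show ?thesis .
qed

subsection \<open>The endpoint with edges only: pairings\<close>

text \<open>\<open>pairings\<close> over an arbitrary point set, so that matched points can be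
  removed in an induction.\<close>

definition perfect_matchings :: "'a set \<Rightarrow> 'a set set set" where
  "perfect_matchings R = {F. F \<subseteq> {{a, b} | a b. a \<in> R \<and> b \<in> R \<and> a \<noteq> b} \<and> (\<forall>x\<in>R. \<exists>!e\<in>F. x \<in> e)}"

lemma finite_perfect_matchings: "finite R \<Longrightarrow> finite (perfect_matchings R)"
  by (rule finite_subset[of _ "Pow (Pow R)"]) (auto simp: perfect_matchings_def)

lemma perfect_matchings_subset: "F \<in> perfect_matchings R \<Longrightarrow> e \<in> F \<Longrightarrow> e \<subseteq> R"
  by (auto simp: perfect_matchings_def)

text \<open>A perfect matching amounts to a choice of the partner \<open>y\<close> of
  \<open>x\<close> and a perfect matching of the rest.\<close>

lemma bij_betw_perfect_matchings_remove:
  assumes x: "x \<in> R"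
  shows "bij_betw (\<lambda>(y, F). insert {x, y} F)
    (SIGMA y:R - {x}. perfect_matchings (R - {x} - {y})) (perfect_matchings R)"
proof (rule bij_betw_imageI)
  show "inj_on (\<lambda>(y, F). insert {x, y} F) (SIGMA y:R - {x}. perfect_matchings (R - {x} - {y}))"
  proof (rule inj_onI)
    fix p p'
    assume p: "p \<in> (SIGMA y:R - {x}. perfect_matchings (R - {x} - {y}))"
      and p': "p' \<in> (SIGMA y:R - {x}. perfect_matchings (R - {x} - {y}))"
      and pp': "(\<lambda>(y, F). insert {x, y} F) p = (\<lambda>(y, F). insert {x, y} F) p'"
    obtain y F y' F' where yF: "p = (y, F)" "p' = (y', F')" by (metis surj_pair)
    have F: "F \<in> perfect_matchings (R - {x} - {y})" and F': "F' \<in> perfect_matchings (R - {x} - {y'})"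
      and eq: "insert {x, y} F = insert {x, y'} F'"
      using p p' pp' yF by auto
    have a: "x \<notin> e" if "e \<in> F" for e using perfect_matchings_subset[OF F that] by auto
    have b: "x \<notin> e" if "e \<in> F'" for e using perfect_matchings_subset[OF F' that] by auto
    have "{x, y} \<in> insert {x, y'} F'" using eq by blast
    then have "{x, y} = {x, y'}" using b by auto
    then have y: "y = y'" by (auto simp: doubleton_eq_iff)
    have "{x, y} \<notin> F" "{x, y} \<notin> F'" using a b by auto
    then show "p = p'" using eq y yF by (simp add: insert_ident)
  qed
next
  show "(\<lambda>(y, F). insert {x, y} F) ` (SIGMA y:R - {x}. perfect_matchings (R - {x} - {y})) = perfect_matchings R"
  proof (intro equalityI subsetI)
    fix F' assume "F' \<in> (\<lambda>(y, F). insert {x, y} F) ` (SIGMA y:R - {x}. perfect_matchings (R - {x} - {y}))"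
    then obtain y F where y: "y \<in> R" "y \<noteq> x" and F: "F \<in> perfect_matchings (R - {x} - {y})"
      and F': "F' = insert {x, y} F" by auto
    have sub: "e \<subseteq> R - {x} - {y}" if "e \<in> F" for e using perfect_matchings_subset[OF F that] .
    have "\<exists>!e\<in>F'. w \<in> e" if w: "w \<in> R" for w
    proof (cases "w = x \<or> w = y")
      case True
      then show ?thesis using sub unfolding F' by (intro ex1I[of _ "{x, y}"]) auto
    next
      case False
      then have "\<exists>!e\<in>F. w \<in> e" using F w by (auto simp: perfect_matchings_def)
      then show ?thesis using False unfolding F' by auto
    qed
    moreover have "F' \<subseteq> {{a, b} | a b. a \<in> R \<and> b \<in> R \<and> a \<noteq> b}"
      using F x y unfolding F' perfect_matchings_def by blast
    ultimately show "F' \<in> perfect_matchings R" by (simp add: perfect_matchings_def)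
  next
    fix F assume F: "F \<in> perfect_matchings R"
    then obtain e where e: "e \<in> F" "x \<in> e" using x by (auto simp: perfect_matchings_def)
    moreover obtain a b where "e = {a, b}" "a \<in> R" "b \<in> R" "a \<noteq> b"
      using F e(1) unfolding perfect_matchings_def by blast
    ultimately obtain y where y: "y \<in> R" "y \<noteq> x" "e = {x, y}"
      by (cases "x = a") (auto simp: insert_commute)
    \<comment> \<open>Edges of a matching that share a point coincide, so the rest of
      \<open>F\<close> avoids \<open>x\<close> and \<open>y\<close>.\<close>
    have uniq: "f = e" if "f \<in> F" "w \<in> f" "w \<in> e" for f w
      using F that e y x unfolding perfect_matchings_def by blast
    have "F - {e} \<in> perfect_matchings (R - {x} - {y})"
      unfolding perfect_matchings_def
    proof (intro CollectI conjI ballI subsetI)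
      fix f assume f: "f \<in> F - {e}"
      then obtain a b where ab: "f = {a, b}" "a \<in> R" "b \<in> R" "a \<noteq> b"
        using F unfolding perfect_matchings_def by blast
      have "x \<notin> f" "y \<notin> f" using uniq[of f] f y by auto
      then show "\<exists>a b. f = {a, b} \<and> a \<in> R - {x} - {y} \<and> b \<in> R - {x} - {y} \<and> a \<noteq> b"
        using ab by blast
    next
      fix w assume w: "w \<in> R - {x} - {y}"
      then have "\<exists>!e\<in>F. w \<in> e" using F by (auto simp: perfect_matchings_def)
      moreover have "w \<notin> e" using w y by auto
      ultimately show "\<exists>!f\<in>F - {e}. w \<in> f" by auto
    qed
    moreover have "F = insert {x, y} (F - {e})" using e y by auto
    ultimately show "F \<in> (\<lambda>(y, F). insert {x, y} F) ` (SIGMA y:R - {x}. perfect_matchings (R - {x} - {y}))"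
      using y by (intro image_eqI[of _ _ "(y, F - {e})"]) auto
  qed
qed

text \<open>Edges are sets of points rather than of vertices, so parallel edges are counted
  separately.\<close>

definition penalize_edges :: "('v \<times> 'k) set set \<Rightarrow> ('v set \<Rightarrow> int) \<Rightarrow> 'v set \<Rightarrow> int" where
  "penalize_edges F J I = J I - int (card {e \<in> F. fst ` e \<subseteq> I})"

lemma penalize_edges_insert:
  assumes "finite F" "{x, y} \<notin> F"
  shows "penalize_edges (insert {x, y} F) J = penalize_edges F (penalize {fst x, fst y} J)"
proof
  fix I
  have "{e \<in> insert {x, y} F. fst ` e \<subseteq> I}
      = (if {fst x, fst y} \<subseteq> I then insert {x, y} {e \<in> F. fst ` e \<subseteq> I} else {e \<in> F. fst ` e \<subseteq> I})"
    by auto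
  then show "penalize_edges (insert {x, y} F) J I = penalize_edges F (penalize {fst x, fst y} J) I"
    using assms by (simp add: penalize_edges_def penalize_def)
qed

text \<open>At \<open>m = 0\<close> the truncated \<open>2 * m - 1\<close> is 0, and
  \<open>dfact 0 = 1\<close> agrees with the convention (-1)!! = 1.\<close>

lemma dfact_odd_step: "dfact (2 * Suc m - 1) = (2 * m + 1) * dfact (2 * m - 1)"
  by (cases m) simp_all

text \<open>A uniform perfect matching can be exposed edge by edge, each time matching a random pair
  of free points.\<close>

lemma sum_perfect_matchings:
  fixes R :: "('v \<times> 'k) set"
  assumes "finite R" "card R = 2 * m"
  shows "(\<Sum>F\<in>perfect_matchings R. \<Psi> (penalize_edges F J) {})
    = real (dfact (2 * m - 1)) * (edge_avg ^^ m) \<Psi> J R"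
  using assms
proof (induction m arbitrary: J R)
  case 0
  then have "R = {}" by simp
  moreover have "perfect_matchings ({} :: ('v \<times> 'k) set) = {{}}" by (auto simp: perfect_matchings_def)
  moreover have "penalize_edges ({} :: ('v \<times> 'k) set set) J = J" by (simp add: penalize_edges_def fun_eq_iff)
  ultimately show ?case by simp
next
  case (Suc m)
  let ?A = "\<Sum>F\<in>perfect_matchings R. \<Psi> (penalize_edges F J) {}"
  let ?E = "\<lambda>x y. (edge_avg ^^ m) \<Psi> (penalize {fst x, fst y} J) (R - {x} - {y})"
  have fin: "finite R" by fact
  have expand: "?A = real (dfact (2 * m - 1)) * (\<Sum>y\<in>R - {x}. ?E x y)" if x: "x \<in> R" for x
  proof -
    have "?A = (\<Sum>p\<in>(SIGMA y:R - {x}. perfect_matchings (R - {x} - {y})).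
        \<Psi> (penalize_edges ((\<lambda>(y, F). insert {x, y} F) p) J) {})"
      by (rule sum.reindex_bij_betw[OF bij_betw_perfect_matchings_remove[OF x], symmetric])
    also have "\<dots> = (\<Sum>y\<in>R - {x}. \<Sum>F\<in>perfect_matchings (R - {x} - {y}).
        \<Psi> (penalize_edges (insert {x, y} F) J) {})"
      using fin by (subst sum.Sigma) (auto simp: finite_perfect_matchings split_def)
    also have "\<dots> = (\<Sum>y\<in>R - {x}. real (dfact (2 * m - 1)) * ?E x y)"
    proof (rule sum.cong[OF refl])
      fix y assume y: "y \<in> R - {x}"
      have "(\<Sum>F\<in>perfect_matchings (R - {x} - {y}). \<Psi> (penalize_edges (insert {x, y} F) J) {})
          = (\<Sum>F\<in>perfect_matchings (R - {x} - {y}). \<Psi> (penalize_edges F (penalize {fst x, fst y} J)) {})"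
      proof (rule sum.cong[OF refl])
        fix F assume F: "F \<in> perfect_matchings (R - {x} - {y})"
        have "F \<subseteq> Pow R" using perfect_matchings_subset[OF F] by auto
        then have "finite F" using fin finite_subset by blast
        moreover have "{x, y} \<notin> F" using perfect_matchings_subset[OF F] by auto
        ultimately show "\<Psi> (penalize_edges (insert {x, y} F) J) {}
            = \<Psi> (penalize_edges F (penalize {fst x, fst y} J)) {}"
          by (simp add: penalize_edges_insert)
      qed
      also have "\<dots> = real (dfact (2 * m - 1)) * ?E x y"
        using Suc x y by (intro Suc.IH) auto
      finally show "(\<Sum>F\<in>perfect_matchings (R - {x} - {y}). \<Psi> (penalize_edges (insert {x, y} F) J) {})
        = real (dfact (2 * m - 1)) * ?E x y" .
    qed
    finally show ?thesis by (simp add: sum_distrib_left)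
  qed
  define r where "r = real (card R)"
  have r: "r = 2 * real m + 2" using Suc.prems by (simp add: r_def)
  \<comment> \<open>The expansion holds for every \<open>x\<close>; summing it over all
    \<open>x\<close> produces the ordered pairs of \<open>edge_avg\<close>.\<close>
  have "r * ?A = (\<Sum>x\<in>R. ?A)" by (simp add: r_def)
  also have "\<dots> = real (dfact (2 * m - 1)) * (\<Sum>x\<in>R. \<Sum>y\<in>R - {x}. ?E x y)"
    unfolding sum_distrib_left[where r = "real (dfact (2 * m - 1))" and A = R]
    by (rule sum.cong[OF refl expand])
  also have "(\<Sum>x\<in>R. \<Sum>y\<in>R - {x}. ?E x y) = r * (r - 1) * (edge_avg ^^ Suc m) \<Psi> J R"
    using r by (simp add: edge_avg_def[of "(edge_avg ^^ m) \<Psi>"] r_def[symmetric])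
  finally have "?A = real (dfact (2 * m - 1)) * (r - 1) * (edge_avg ^^ Suc m) \<Psi> J R"
    using r by simp
  then show ?case using r by (simp only: dfact_odd_step) (simp add: algebra_simps)
qed

text \<open>Joins the two endpoints: edges only gives the average over pairings, fields only gives
  the explicit product.\<close>

lemma sum_pairings_boltzmann_le:
  assumes q: "0 < q" "q < 1" and z: "1 < z" and n: "3 * n = 2 * (T + L)" and L: "1 < L"
  shows "(\<Sum>F\<in>pairings n. z powi ground {1..n} (penalize_edges F (\<lambda>I. int (card I))))
    \<le> real (dfact (3 * n - 1)) * exp (real n * ln (1 + (z - 1) * (1 - q) ^ 3)
      + real T * (ln (1 + (z - 1) / (real L - 1)) - ln (1 - (1 - 1 / z) * q\<^sup>2) + ln z / real L) + 3 * real L * ln z)"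
proof -
  define V where "V = {1..n}"
  interpret interpolation V q z by unfold_locales (use q z in \<open>auto simp: V_def\<close>)
  let ?J = "\<lambda>I :: nat set. int (card I)"
  let ?P = "V \<times> {1..3::nat}"
  have card_P: "card ?P = 2 * (T + L)" using V_def n by (simp add: card_cartesian_product)
  have fin: "finite ?P" using finite_V by simp
  have "pairings n = perfect_matchings ?P"
    by (simp add: pairings_def perfect_matchings_def points_def V_def)
  moreover have "partition_fn ?J ?P (T + L) 0 = (edge_avg ^^ (T + L)) (boltzmann V z) ?J ?P"
    by (simp add: partition_fn_def mixed_avg_def)
  moreover have "(\<Sum>F\<in>perfect_matchings ?P. z powi ground V (penalize_edges F ?J))
      = real (dfact (2 * (T + L) - 1)) * (edge_avg ^^ (T + L)) (boltzmann V z) ?J ?P"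
    using sum_perfect_matchings[OF fin card_P, of "boltzmann V z" ?J] unfolding boltzmann_def .
  ultimately have "(\<Sum>F\<in>pairings n. z powi ground {1..n} (penalize_edges F ?J))
      = real (dfact (3 * n - 1)) * partition_fn ?J ?P (T + L) 0"
    unfolding n V_def by simp
  also have "partition_fn ?J ?P (T + L) 0 \<le> exp (real n * ln (1 + (z - 1) * (1 - q) ^ 3)
      + real T * (ln (1 + (z - 1) / (real L - 1)) - ln (1 - (1 - 1 / z) * q\<^sup>2) + ln z / real L) + 3 * real L * ln z)"
  proof -
    have base: "0 < 1 + (z - 1) * (1 - q) ^ 3" using z q by (simp add: add_pos_nonneg)
    have "0 < partition_fn ?J ?P (T + L) 0" "0 < partition_fn ?J ?P 0 (card ?P)"
      using card_P by (auto intro!: partition_fn_pos)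
    moreover have "ln (partition_fn ?J ?P 0 (card ?P)) \<le> real n * ln (1 + (z - 1) * (1 - q) ^ 3)"
      using partition_fn_all_fields_le[of "{1..3::nat}"] calculation(2) base V_def
      by (simp add: ln_realpow[symmetric])
    ultimately show ?thesis
      using partition_fn_interpolation[OF card_P L, of ?J, unfolded \<kappa>_def] by (subst ln_le_cancel_iff[symmetric]) auto
  qed
  finally show ?thesis by (simp add: mult_left_mono)
qed

subsection \<open>The independence number\<close>

text \<open>A maximum independent set pays no penalty. Since \<open>adj\<close> ignores loops,
  \<open>simple_proj\<close> is what excludes an edge projecting to a single vertex of the
  set.\<close>

lemma alpha_le_ground:
  assumes "simple_proj F"
  shows "int (alpha n F) \<le> ground {1..n} (penalize_edges F (\<lambda>I. int (card I)))"
proof -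
  have "finite {card S | S. independent n F S}"
    by (rule finite_subset[of _ "card ` Pow {1..n}"]) (auto simp: independent_def)
  moreover have "independent n F {}" by (simp add: independent_def)
  ultimately have "alpha n F \<in> {card S | S. independent n F S}"
    unfolding alpha_def by (intro Max_in) auto
  then obtain S where S: "independent n F S" "alpha n F = card S" by auto
  have "\<not> fst ` e \<subseteq> S" if e: "e \<in> F" for e
  proof
    assume sub: "fst ` e \<subseteq> S"
    have "card (fst ` e) = 2" using assms e by (simp add: simple_proj_def)
    then obtain u v where uv: "fst ` e = {u, v}" "u \<noteq> v" by (auto simp: card_2_iff)
    then have "adj F u v" using e by (auto simp: adj_def)
    then show False using S(1) sub uv by (auto simp: independent_def)
  qed
  then have none: "{e \<in> F. fst ` e \<subseteq> S} = {}" by blast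
  have "penalize_edges F (\<lambda>I. int (card I)) S = int (alpha n F)"
    unfolding penalize_edges_def none using S by simp
  then show ?thesis
    using ground_ge[of "{1..n}" S "penalize_edges F (\<lambda>I. int (card I))"] S by (simp add: independent_def)
qed

section \<open>Numerical gap and Markov's inequality\<close>

lemma exponent_gap: "ln (27 / 10) / 2 < 0.454 * ln (3 :: real)"
proof -
  \<comment> \<open>The claim multiplied by 500 and exponentiated, as 0.454 is 227/500.\<close>
  have "(27::real) ^ 250 < 3 ^ 227 * 10 ^ 250" by simp
  then have "(27 :: real) ^ 250 / 10 ^ 250 < 3 ^ 227"
    by (simp only: pos_divide_less_eq zero_less_power zero_less_numeral)
  then have "(27 / 10 :: real) ^ 250 < 3 ^ 227" unfolding power_divide .
  then have "ln ((27 / 10 :: real) ^ 250) < ln (3 ^ 227)" by (subst ln_less_cancel_iff) simp_all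
  then have "250 * ln (27 / 10 :: real) < 227 * ln 3" by (simp only: ln_realpow)
  then show ?thesis by simp
qed

theorem theorem5:
  shows "\<forall>\<epsilon>::real. \<epsilon> > 0 \<longrightarrow> (\<exists>N::nat. N > 0 \<and> (\<forall>n::nat. even n \<and> n > N \<longrightarrow>
     real (card {F \<in> Gprime 16 n. real (alpha n F) > 0.454 * real n})
       < \<epsilon> * real (dfact (3 * n - 1))))"
proof (intro allI impI)
  fix \<epsilon> :: real assume \<epsilon>: "0 < \<epsilon>"
  \<comment> \<open>The exponential gap per vertex: half of it absorbs the interpolation error, the
    other half gives the decay.\<close>
  define \<delta> where "\<delta> = 0.454 * ln (3::real) - ln (27 / 10) / 2"
  have \<delta>: "0 < \<delta>" using exponent_gap by (simp add: \<delta>_def)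
  obtain L :: nat where L': "12 / \<delta> + 1 < real L" using reals_Archimedean2 by blast
  have "0 < 12 / \<delta>" using \<delta> by simp
  then have L: "1 < L" "1 < real L" using L' by linarith+
  \<comment> \<open>Error per traded edge. At most \<open>3 / 2 * real n\<close> edges are traded,
    so the total stays within \<open>real n * (\<delta> / 2)\<close>.\<close>
  have err: "ln (1 + 2 / (real L - 1)) + ln 3 / real L < \<delta> / 3"
  proof -
    have "ln (1 + 2 / (real L - 1)) \<le> 2 / (real L - 1)" using L by (intro ln_add_one_self_le_self) simp
    moreover have "ln (3::real) \<le> 2" using ln_add_one_self_le_self[of 2] by simp
    then have "ln 3 / real L \<le> 2 / (real L - 1)" using L by (intro frac_le) auto
    moreover have "4 / (real L - 1) < \<delta> / 3" using L' L \<delta> by (simp add: field_simps)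
    moreover have "4 / (real L - 1) = 2 / (real L - 1) + 2 / (real L - 1)"
      by (simp add: add_divide_distrib[symmetric])
    ultimately show ?thesis by linarith
  qed
  \<comment> \<open>Makes \<open>exp (3 * real L * ln 3 - real n * (\<delta> / 2))\<close> less than
    \<open>\<epsilon>\<close> for \<open>n > M\<close>.\<close>
  obtain M :: nat where M: "(3 * real L * ln 3 - ln \<epsilon>) * 2 / \<delta> < real M" using reals_Archimedean2 by blast
  show "\<exists>N::nat. N > 0 \<and> (\<forall>n::nat. even n \<and> n > N \<longrightarrow>
     real (card {F \<in> Gprime 16 n. real (alpha n F) > 0.454 * real n}) < \<epsilon> * real (dfact (3 * n - 1)))"
  proof (intro exI[of _ "L + M"] conjI allI impI)
    show "0 < L + M" using L by simp
    fix n :: nat assume n: "even n \<and> L + M < n"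
    \<comment> \<open>The division is exact because \<open>n\<close> is even, and
      \<open>L < n\<close> prevents truncation of the subtraction.\<close>
    define T where "T = 3 * n div 2 - L"
    have T: "3 * n = 2 * (T + L)" using n by (auto simp: T_def elim!: evenE)
    let ?g = "\<lambda>F. ground {1..n} (penalize_edges F (\<lambda>I. int (card I)))"
    let ?B = "{F \<in> Gprime 16 n. real (alpha n F) > 0.454 * real n}"
    let ?D = "real (dfact (3 * n - 1))"
    have Dpos: "0 < ?D"
    proof -
      have "0 < dfact k" for k by (induction k rule: dfact.induct) auto
      then show ?thesis by simp
    qed
    have "finite (pairings n)"
      using finite_perfect_matchings[of "points n"]
      by (simp add: pairings_def perfect_matchings_def points_def)
    \<comment> \<open>Markov's inequality: each counted pairing contributes at least 3 to the power
      \<open>0.454 * real n\<close>.\<close>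
    have "real (card ?B) * exp (0.454 * real n * ln 3) = (\<Sum>F\<in>?B. exp (0.454 * real n * ln 3))" by simp
    also have "\<dots> \<le> (\<Sum>F\<in>?B. 3 powi ?g F)"
    proof (rule sum_mono)
      fix F assume F: "F \<in> ?B"
      then have "int (alpha n F) \<le> ?g F" by (intro alpha_le_ground) (simp add: Gprime_def)
      then have "(3::real) powi int (alpha n F) \<le> 3 powi ?g F" by (intro power_int_increasing) auto
      moreover have "exp (0.454 * real n * ln 3) \<le> exp (real (alpha n F) * ln 3)"
        using F by (simp add: mult_right_mono)
      moreover have "exp (real (alpha n F) * ln 3) = (3::real) powi int (alpha n F)"
        by (simp add: exp_of_nat_mult)
      ultimately show "exp (0.454 * real n * ln 3) \<le> (3::real) powi ?g F" by linarith
    qed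
    also have "\<dots> \<le> (\<Sum>F\<in>pairings n. 3 powi ?g F)"
      using \<open>finite (pairings n)\<close> by (intro sum_mono2) (auto simp: Gprime_def)
    also have "\<dots> \<le> ?D * exp (real n * ln (1 + (3 - 1) * (1 - 1 / 2) ^ 3)
      + real T * (ln (1 + (3 - 1) / (real L - 1)) - ln (1 - (1 - 1 / 3) * (1 / 2)\<^sup>2) + ln 3 / real L) + 3 * real L * ln 3)"
      by (rule sum_pairings_boltzmann_le[OF _ _ _ T L(1)]) auto
    also have "\<dots> \<le> ?D * exp (0.454 * real n * ln 3 - real n * (\<delta> / 2) + 3 * real L * ln 3)"
    proof -
      have l1: "ln (1 + (3 - 1) * (1 - 1 / 2) ^ 3) = ln (5 / 4 :: real)" by (simp add: power3_eq_cube)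
      have l2: "ln (1 - (1 - 1 / 3) * (1 / 2)\<^sup>2) = ln (5 / 6 :: real)" by (simp add: power2_eq_square)
      \<comment> \<open>The squared base: 5/4 per vertex from the fields, and a factor 6/5 for each
        of the 3/2 edges per vertex.\<close>
      have "ln (27 / 10 :: real) = ln ((5 / 4) ^ 2 / (5 / 6) ^ 3)" by (simp add: power2_eq_square power3_eq_cube)
      also have "\<dots> = 2 * ln (5 / 4) - 3 * ln (5 / 6)"
        by (simp only: ln_div ln_realpow) (simp add: ln_div ln_realpow)
      finally have l3: "ln (27 / 10 :: real) = 2 * ln (5 / 4) - 3 * ln (5 / 6)" .
      have "3 * real n = 2 * (real T + real L)" using arg_cong[OF T, of real] by simp
      then have T_le: "real T \<le> 3 / 2 * real n" by simp
      have "ln (5 / 6 :: real) \<le> 0" by simp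
      moreover have "0 \<le> ln (1 + 2 / (real L - 1)) + ln 3 / real L" using L by simp
      ultimately have nonneg: "0 \<le> ln (1 + 2 / (real L - 1)) - ln (5 / 6) + ln 3 / real L" by linarith
      have "real T * (ln (1 + 2 / (real L - 1)) - ln (5 / 6) + ln 3 / real L)
          \<le> (3 / 2 * real n) * (ln (1 + 2 / (real L - 1)) - ln (5 / 6) + ln 3 / real L)"
        using T_le nonneg by (rule mult_right_mono)
      also have "\<dots> \<le> (3 / 2 * real n) * (\<delta> / 3 - ln (5 / 6))"
        using err by (intro mult_left_mono) auto
      also have "\<dots> = real n * (ln (27 / 10) / 2 + \<delta> / 2) - real n * ln (5 / 4)"
        unfolding l3 by (simp add: algebra_simps add_divide_distrib diff_divide_distrib)
      finally have "real n * ln (5 / 4) + real T * (ln (1 + 2 / (real L - 1)) - ln (5 / 6) + ln 3 / real L)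
          \<le> real n * (ln (27 / 10) / 2 + \<delta> / 2)"
        by linarith
      also have "\<dots> = 0.454 * real n * ln 3 - real n * (\<delta> / 2)"
        by (simp add: \<delta>_def algebra_simps)
      finally show ?thesis
        unfolding l1 l2 using Dpos by simp
    qed
    also have "\<dots> = ?D * exp (3 * real L * ln 3 - real n * (\<delta> / 2)) * exp (0.454 * real n * ln 3)"
      by (simp add: exp_add[symmetric] algebra_simps)
    finally have "real (card ?B) \<le> ?D * exp (3 * real L * ln 3 - real n * (\<delta> / 2))"
      by simp
    also have "\<dots> < ?D * \<epsilon>"
    proof -
      have "(3 * real L * ln 3 - ln \<epsilon>) * 2 / \<delta> < real n" using M n by linarith
      then have "3 * real L * ln 3 - real n * (\<delta> / 2) < ln \<epsilon>" using \<delta> by (simp add: field_simps)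
      then have "exp (3 * real L * ln 3 - real n * (\<delta> / 2)) < \<epsilon>"
        using \<epsilon> by (metis exp_less_mono exp_ln)
      then show ?thesis using Dpos by simp
    qed
    finally show "real (card ?B) < \<epsilon> * ?D" by (simp add: mult.commute)
  qed
qed

end
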